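(* Fix an integer $q\ge1$. For integers $k>q$ let $Q_k=\{-1,1\}^k$ and $\mathcal{B}_{k-q}^k=\mathrm{Lin}\{w_S:S\subset\{1,\ldots,k\},\ |S|\le k-q\}\subset\mathbb{R}^{Q_k}$, where $w_S(x)=\prod_{i\in S}x_i$. Then $k2^k$ is a threshold of the sample size for the existence of the maximum likelihood estimator (MLE) for $e(\mathcal{B}_{k-q}^k)$ and i.i.d. samples uniform on $Q_k$. That is, for every sequence of positive integers $n(k)$, with $X_1,\ldots,X_{n(k)}$ independent and uniformly distributed on $Q_k$, $$\lim_{k\to\infty}\mathbb{P}\left(\text{the MLE for }e(\mathcal{B}_{k-q}^k)\text{ and }X_1,\ldots,X_{n(k)}\text{ exists}\right)=\begin{cases}0&\text{if }n(k)/(k2^k)\to0,\\1&\text{if }n(k)/(k2^k)\to\infty.\end{cases}$$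
   Context: The weight on $Q_k$ is $\mu(\chi)=2^{-k}$. For $\phi\in\mathbb{R}^{Q_k}$ let $e(\phi)=e^{\phi}/\sum_{x\in Q_k}e^{\phi(x)}\mu(x)$, and $e(\mathcal{B})=\{e(\phi):\phi\in\mathcal{B}\}$ for a linear subspace $\mathcal{B}\subset\mathbb{R}^{Q_k}$. An element $\hat p\in e(\mathcal{B})$ is the MLE for $e(\mathcal{B})$ and $x_1,\ldots,x_n\in Q_k$ if $\prod_{i=1}^n\hat p(x_i)=\sup_{p\in e(\mathcal{B})}\prod_{i=1}^np(x_i)$. *)

theory Defs
  imports "HOL-Probability.Probability" "HOL-Library.Function_Algebras"
begin

text \<open>
  Points of the hypercube are extensional functions, so the set \<open>Q k\<close> has exactly
  \<open>2 ^ k\<close> elements.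
\<close>

definition Q :: "nat \<Rightarrow> (nat \<Rightarrow> real) set" where
  "Q k = {1..k} \<rightarrow>\<^sub>E {-1, 1}"

definition mu :: "nat \<Rightarrow> (nat \<Rightarrow> real) \<Rightarrow> real" where
  "mu k x = 1 / 2 ^ k"

text \<open>
  The space of real functions on \<open>Q k\<close> is represented by the functions on the ambient type
  that vanish outside \<open>Q k\<close>; addition is pointwise, from the library instance for functions.
\<close>

definition walsh :: "nat \<Rightarrow> nat set \<Rightarrow> (nat \<Rightarrow> real) \<Rightarrow> real" where
  "walsh k S x = (if x \<in> Q k then (\<Prod>i\<in>S. x i) else 0)"

global_interpretation fun_space: vector_space "\<lambda>(c::real) (f :: 'a \<Rightarrow> real) x. c * f x"
  by unfold_locales (auto simp: fun_eq_iff algebra_simps)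

definition walsh_space :: "nat \<Rightarrow> nat \<Rightarrow> ((nat \<Rightarrow> real) \<Rightarrow> real) set" where
  "walsh_space k d = fun_space.span {walsh k S | S. S \<subseteq> {1..k} \<and> card S \<le> d}"

definition exp_density :: "nat \<Rightarrow> ((nat \<Rightarrow> real) \<Rightarrow> real) \<Rightarrow> (nat \<Rightarrow> real) \<Rightarrow> real" where
  "exp_density k \<phi> x =
     (if x \<in> Q k then exp (\<phi> x) / (\<Sum>y\<in>Q k. exp (\<phi> y) * mu k y) else 0)"

definition exp_family ::
    "nat \<Rightarrow> ((nat \<Rightarrow> real) \<Rightarrow> real) set \<Rightarrow> ((nat \<Rightarrow> real) \<Rightarrow> real) set" where
  "exp_family k B = exp_density k ` B"

text \<open>
  For nonempty \<open>B\<close> the supremum below is a genuine one: every density is bounded by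
  \<open>2 ^ k\<close>, so the set of likelihoods is nonempty and bounded.
\<close>

definition is_MLE ::
    "nat \<Rightarrow> ((nat \<Rightarrow> real) \<Rightarrow> real) set \<Rightarrow> nat \<Rightarrow> (nat \<Rightarrow> nat \<Rightarrow> real)
      \<Rightarrow> ((nat \<Rightarrow> real) \<Rightarrow> real) \<Rightarrow> bool" where
  "is_MLE k B n x p \<longleftrightarrow>
     p \<in> exp_family k B \<and>
     (\<Prod>i=1..n. p (x i)) = (SUP p'\<in>exp_family k B. \<Prod>i=1..n. p' (x i))"

definition MLE_exists ::
    "nat \<Rightarrow> ((nat \<Rightarrow> real) \<Rightarrow> real) set \<Rightarrow> nat \<Rightarrow> (nat \<Rightarrow> nat \<Rightarrow> real) \<Rightarrow> bool" where
  "MLE_exists k B n x \<longleftrightarrow> (\<exists>p. is_MLE k B n x p)"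

definition iid_uniform ::
    "'a measure \<Rightarrow> nat \<Rightarrow> nat \<Rightarrow> (nat \<Rightarrow> 'a \<Rightarrow> nat \<Rightarrow> real) \<Rightarrow> bool" where
  "iid_uniform M k n X \<longleftrightarrow>
     prob_space.indep_vars M (\<lambda>_. count_space (Q k)) X {1..n} \<and>
     (\<forall>i\<in>{1..n}. distr M (count_space (Q k)) (X i) = uniform_count_measure (Q k))"

end

theory Submission
  imports Defs
begin

text \<open>
  The threshold is that of the coupon collector's problem: the time until the sample has seen every
  point of the cube and the time until it has met every subcube of dimension \<open>q\<close> are both of order
  \<open>k * 2 ^ k\<close>, and the existence of the MLE lies between these two events.

  If every point of the cube occurs in the sample, the MLE exists
  (\<open>MLE_exists_if_all_points_sampled\<close>): a density competing for the maximum is then bounded below on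
  the whole cube, and the densities of the family with a given positive lower bound form a compact
  set. A union bound over the points shows that all of them have been seen with probability tending
  to \<open>1\<close> when \<open>n k / (k * 2 ^ k)\<close> tends to infinity (\<open>prob_MLE_exists_ge\<close>).

  If some subcube of dimension \<open>q\<close> is missed, the MLE does not exist
  (\<open>MLE_not_exists_if_nonneg_direction_missed\<close>): the indicator of such a subcube depends on only
  \<open>k - q\<close> coordinates and hence lies in the space, and lowering \<open>\<phi>\<close> along it increases the
  likelihood strictly. The cube splits into \<open>2 ^ (k - q)\<close> disjoint such subcubes, each of which is
  missed with probability about \<open>exp (- 2 ^ q * n k / 2 ^ k)\<close>. When \<open>n k / (k * 2 ^ k)\<close> tends to \<open>0\<close>
  the mean number of missed subcubes tends to infinity, and since the events that disjoint subcubes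
  are missed are negatively correlated, the second moment method shows that one of them is missed
  with probability tending to \<open>1\<close> (\<open>prob_MLE_exists_le\<close>).
\<close>

section \<open>Fourier analysis on the hypercube\<close>

lemma finite_Q [simp]: "finite (Q k)"
  unfolding Q_def by (intro finite_PiE) auto

lemma card_Q: "card (Q k) = 2 ^ k"
  unfolding Q_def by (subst card_PiE) (auto simp: card_insert_if numeral_2_eq_2)

lemma Q_nonempty: "Q k \<noteq> {}"
  using card_Q[of k] by force

lemma Q_coordinate: "x \<in> Q k \<Longrightarrow> i \<in> {1..k} \<Longrightarrow> x i = -1 \<or> x i = 1"
  unfolding Q_def using PiE_mem[of x "{1..k}" "\<lambda>_. {-1,1}" i] by simp

lemma Q_eqI: "x \<in> Q k \<Longrightarrow> y \<in> Q k \<Longrightarrow> (\<And>i. i \<in> {1..k} \<Longrightarrow> x i = y i) \<Longrightarrow> x = y"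
  unfolding Q_def by (rule PiE_ext)

text \<open>
  The sum over the cube factorises over the coordinates, and a coordinate that lies in exactly one
  of \<open>S\<close> and \<open>T\<close> contributes the factor \<open>-1 + 1 = 0\<close>.
\<close>

lemma walsh_orthogonal:
  assumes "S \<subseteq> {1..k}" "T \<subseteq> {1..k}" "S \<noteq> T"
  shows "(\<Sum>x\<in>Q k. (\<Prod>i\<in>S. x i) * (\<Prod>i\<in>T. x i)) = 0"
proof -
  have as_full: "(\<Prod>i\<in>R. x i) = (\<Prod>i\<in>{1..k}. if i \<in> R then x i else 1)"
    if "R \<subseteq> {1..k}" for R and x :: "nat \<Rightarrow> real"
    using that by (simp add: prod.If_cases Int_absorb1)
  obtain i where i: "i \<in> {1..k}" "i \<in> S \<longleftrightarrow> i \<notin> T"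
    using assms by blast
  have "(\<Sum>x\<in>Q k. (\<Prod>i\<in>S. x i) * (\<Prod>i\<in>T. x i))
      = (\<Sum>x\<in>Q k. \<Prod>i\<in>{1..k}. (if i \<in> S then x i else 1) * (if i \<in> T then x i else 1))"
    by (simp only: as_full[OF assms(1)] as_full[OF assms(2)] prod.distrib)
  also have "\<dots> = (\<Prod>i\<in>{1..k}. \<Sum>a\<in>{-1,1}. (if i \<in> S then a else 1) * (if i \<in> T then a else 1))"
    unfolding Q_def by (subst prod_sum_PiE) auto
  also have "\<dots> = 0"
    by (rule prod_zero) (use i in auto)
  finally show ?thesis .
qed

text \<open>
  The sum is the expansion of \<open>\<Prod>i\<in>J. 1 + y i * x i\<close>, each factor of which is \<open>2\<close> or \<open>0\<close>
  according to whether \<open>x\<close> and \<open>y\<close> agree at \<open>i\<close>. For \<open>J\<close> the set of all coordinates this is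
  completeness of the Walsh system; for smaller \<open>J\<close> it shows that the indicator of a subcube
  obtained by fixing the coordinates in \<open>J\<close> involves only the Walsh functions of subsets of \<open>J\<close>.
\<close>

lemma subcube_indicator_walsh:
  assumes "J \<subseteq> {1..k}" "x \<in> Q k" "y \<in> Q k"
  shows "(\<Sum>S\<in>Pow J. (\<Prod>i\<in>S. y i) * (\<Prod>i\<in>S. x i)) = (if \<forall>i\<in>J. x i = y i then 2 ^ card J else 0)"
proof -
  have J: "finite J" using assms(1) finite_subset by blast
  have "(\<Sum>S\<in>Pow J. (\<Prod>i\<in>S. y i) * (\<Prod>i\<in>S. x i)) = (\<Prod>i\<in>J. y i * x i + 1)"
    using J by (simp add: prod_add prod.distrib)
  also have "\<dots> = (if \<forall>i\<in>J. x i = y i then 2 ^ card J else 0)"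
  proof (cases "\<forall>i\<in>J. x i = y i")
    case True
    have "y i * x i + 1 = 2" if "i \<in> J" for i
    proof -
      have "y i = -1 \<or> y i = 1" using that assms(1) Q_coordinate[OF assms(3), of i] by blast
      moreover have "x i = y i" using True that by blast
      ultimately show ?thesis by auto
    qed
    then show ?thesis using True by simp
  next
    case False
    then obtain i where i: "i \<in> J" "x i \<noteq> y i" by auto
    then have "(x i = -1 \<or> x i = 1) \<and> (y i = -1 \<or> y i = 1)"
      using assms(1) Q_coordinate[OF assms(2), of i] Q_coordinate[OF assms(3), of i] by blast
    then have "y i * x i + 1 = 0" using i(2) by auto
    then show ?thesis using J i False by (auto intro!: prod_zero)
  qed
  finally show ?thesis .
qed

lemma walsh_completeness:
  assumes "x \<in> Q k" "y \<in> Q k"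
  shows "(\<Sum>S\<in>Pow {1..k}. (\<Prod>i\<in>S. y i) * (\<Prod>i\<in>S. x i)) = (if x = y then 2 ^ k else 0)"
proof -
  have "(\<forall>i\<in>{1..k}. x i = y i) \<longleftrightarrow> x = y" using Q_eqI[OF assms] by blast
  then show ?thesis using subcube_indicator_walsh[OF subset_refl assms] by simp
qed

lemma walsh_combination_in_walsh_space:
  assumes "finite F" "\<And>S. S \<in> F \<Longrightarrow> S \<subseteq> {1..k} \<and> card S \<le> d"
  shows "(\<lambda>x. \<Sum>S\<in>F. c S * walsh k S x) \<in> walsh_space k d"
  using assms
proof (induction F)
  case empty
  show ?case using fun_space.span_zero by (simp add: walsh_space_def zero_fun_def)
next
  case (insert S F)
  have "walsh k S \<in> walsh_space k d"
    unfolding walsh_space_def by (rule fun_space.span_base) (use insert.prems in auto)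
  moreover have "(\<lambda>x. \<Sum>S\<in>F. c S * walsh k S x) \<in> walsh_space k d"
    using insert by blast
  ultimately have "(\<lambda>x. c S * walsh k S x) + (\<lambda>x. \<Sum>S\<in>F. c S * walsh k S x) \<in> walsh_space k d"
    unfolding walsh_space_def by (rule fun_space.span_add[OF fun_space.span_scale])
  then show ?case using insert by (simp add: plus_fun_def)
qed

text \<open>
  A function belongs to the span of the low Walsh functions iff its high Fourier coefficients
  vanish. This turns membership in a span into finitely many linear equations, which is how the
  space is seen to be closed under limits.
\<close>

lemma walsh_space_iff:
  "f \<in> walsh_space k d \<longleftrightarrow>
     (\<forall>x. x \<notin> Q k \<longrightarrow> f x = 0) \<and>
     (\<forall>T. T \<subseteq> {1..k} \<and> card T > d \<longrightarrow> (\<Sum>x\<in>Q k. f x * (\<Prod>i\<in>T. x i)) = 0)"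
  (is "_ \<longleftrightarrow> ?supp f \<and> ?orth f")
proof
  assume "f \<in> walsh_space k d"
  then show "?supp f \<and> ?orth f"
    unfolding walsh_space_def
  proof (induction rule: fun_space.span_induct_alt)
    case base
    then show ?case by simp
  next
    case (step c g f)
    then obtain S where S: "g = walsh k S" "S \<subseteq> {1..k}" "card S \<le> d" by auto
    have orth: "(\<Sum>x\<in>Q k. g x * (\<Prod>i\<in>T. x i)) = 0" if "T \<subseteq> {1..k}" "card T > d" for T
    proof -
      have "S \<noteq> T" using S(3) that(2) by auto
      then show ?thesis
        using walsh_orthogonal[OF S(2) that(1)] by (simp add: S(1) walsh_def)
    qed
    have "(\<Sum>x\<in>Q k. (c * g x + f x) * (\<Prod>i\<in>T. x i))
        = c * (\<Sum>x\<in>Q k. g x * (\<Prod>i\<in>T. x i)) + (\<Sum>x\<in>Q k. f x * (\<Prod>i\<in>T. x i))" for T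
      by (simp add: sum.distrib algebra_simps sum_distrib_left)
    then show ?case using step orth S by (auto simp: walsh_def)
  qed
next
  assume f: "?supp f \<and> ?orth f"
  define c where "c S = (\<Sum>y\<in>Q k. f y * (\<Prod>i\<in>S. y i)) / 2 ^ k" for S
  define F where "F = {S \<in> Pow {1..k}. card S \<le> d}"
  have "f x = (\<Sum>S\<in>F. c S * walsh k S x)" for x
  proof (cases "x \<in> Q k")
    case True
    have "(\<Sum>S\<in>F. c S * walsh k S x) = (\<Sum>S\<in>Pow {1..k}. c S * walsh k S x)"
      using f by (intro sum.mono_neutral_left) (auto simp: F_def c_def)
    also have "\<dots> = (\<Sum>S\<in>Pow {1..k}. \<Sum>y\<in>Q k. f y / 2 ^ k * ((\<Prod>i\<in>S. y i) * (\<Prod>i\<in>S. x i)))"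
    proof (intro sum.cong refl)
      fix S
      have "c S * walsh k S x = (\<Sum>y\<in>Q k. f y * (\<Prod>i\<in>S. y i)) * ((\<Prod>i\<in>S. x i) / 2 ^ k)"
        using True by (simp add: c_def walsh_def)
      also have "\<dots> = (\<Sum>y\<in>Q k. f y / 2 ^ k * ((\<Prod>i\<in>S. y i) * (\<Prod>i\<in>S. x i)))"
        unfolding sum_distrib_right by (intro sum.cong refl) simp
      finally show "c S * walsh k S x = \<dots>" .
    qed
    also have "\<dots> = (\<Sum>y\<in>Q k. f y / 2 ^ k * (\<Sum>S\<in>Pow {1..k}. (\<Prod>i\<in>S. y i) * (\<Prod>i\<in>S. x i)))"
      by (subst sum.swap) (simp add: sum_distrib_left)
    also have "\<dots> = (\<Sum>y\<in>Q k. if y = x then f x else 0)"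
      by (intro sum.cong refl) (use walsh_completeness[OF True] in auto)
    also have "\<dots> = f x" using True by simp
    finally show ?thesis ..
  next
    case False
    then show ?thesis using f by (simp add: walsh_def)
  qed
  then have "f = (\<lambda>x. \<Sum>S\<in>F. c S * walsh k S x)" by (rule ext)
  moreover have "(\<lambda>x. \<Sum>S\<in>F. c S * walsh k S x) \<in> walsh_space k d"
    by (rule walsh_combination_in_walsh_space) (auto simp: F_def)
  ultimately show "f \<in> walsh_space k d" by (simp only:)
qed

lemma subcube_indicator_in_walsh_space:
  assumes "J \<subseteq> {1..k}" "card J \<le> d" "y \<in> Q k"
  shows "(\<lambda>x. if x \<in> Q k \<and> (\<forall>i\<in>J. x i = y i) then 1 else 0) \<in> walsh_space k d"
proof -
  have J: "finite J" using assms(1) finite_subset by blast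
  have "(\<lambda>x. if x \<in> Q k \<and> (\<forall>i\<in>J. x i = y i) then 1 else 0)
      = (\<lambda>x. (\<Sum>S\<in>Pow J. (\<Prod>i\<in>S. y i) / 2 ^ card J * walsh k S x))"
  proof
    fix x
    show "(if x \<in> Q k \<and> (\<forall>i\<in>J. x i = y i) then 1 else 0)
      = (\<Sum>S\<in>Pow J. (\<Prod>i\<in>S. y i) / 2 ^ card J * walsh k S x)"
    proof (cases "x \<in> Q k")
      case True
      have "(\<Sum>S\<in>Pow J. (\<Prod>i\<in>S. y i) / 2 ^ card J * walsh k S x)
         = (\<Sum>S\<in>Pow J. (\<Prod>i\<in>S. y i) * (\<Prod>i\<in>S. x i)) / 2 ^ card J"
        using True by (simp add: walsh_def sum_divide_distrib)
      then show ?thesis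
        using subcube_indicator_walsh[OF assms(1) True assms(3)] True by simp
    qed (simp add: walsh_def)
  qed
  moreover have "(\<lambda>x. \<Sum>S\<in>Pow J. (\<Prod>i\<in>S. y i) / 2 ^ card J * walsh k S x) \<in> walsh_space k d"
  proof (rule walsh_combination_in_walsh_space)
    fix S assume "S \<in> Pow J"
    then show "S \<subseteq> {1..k} \<and> card S \<le> d"
      using assms(1,2) card_mono[OF J, of S] by auto
  qed (use J in simp)
  ultimately show ?thesis by (simp only:)
qed

lemma constant_in_walsh_space: "(\<lambda>x. if x \<in> Q k then c else 0) \<in> walsh_space k d"
proof -
  have "(\<lambda>x. \<Sum>S\<in>{{}}. c * walsh k S x) \<in> walsh_space k d"
    by (rule walsh_combination_in_walsh_space) auto
  moreover have "(\<lambda>x. \<Sum>S\<in>{{}}. c * walsh k S x) = (\<lambda>x. if x \<in> Q k then c else 0)"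
    by (auto simp: walsh_def)
  ultimately show ?thesis by (simp only:)
qed

lemma walsh_space_diff: "f \<in> walsh_space k d \<Longrightarrow> g \<in> walsh_space k d \<Longrightarrow> (\<lambda>x. f x - g x) \<in> walsh_space k d"
  unfolding walsh_space_def using fun_space.span_diff[of f _ g] by (simp add: fun_diff_def)

section \<open>Exponential families\<close>

lemma partition_function_pos: "(\<Sum>y\<in>Q k. exp (\<phi> y) * mu k y) > 0"
  using Q_nonempty by (intro sum_pos) (auto simp: mu_def)

lemma exp_density_pos: "x \<in> Q k \<Longrightarrow> exp_density k \<phi> x > 0"
  using partition_function_pos[of \<phi> k] by (simp add: exp_density_def)

lemma exp_density_nonneg: "exp_density k \<phi> x \<ge> 0"
  using partition_function_pos[of \<phi> k] by (simp add: exp_density_def)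

lemma exp_density_le: "exp_density k \<phi> x \<le> 2 ^ k"
proof (cases "x \<in> Q k")
  case True
  have "exp (\<phi> x) * mu k x \<le> (\<Sum>y\<in>Q k. exp (\<phi> y) * mu k y)"
    by (rule member_le_sum) (use True in \<open>auto simp: mu_def\<close>)
  then show ?thesis
    using True partition_function_pos[of \<phi> k] by (simp add: exp_density_def mu_def field_simps)
qed (simp add: exp_density_def)

lemma exp_density_normalized: "(\<Sum>x\<in>Q k. exp_density k \<phi> x * mu k x) = 1"
proof -
  have "(\<Sum>x\<in>Q k. exp_density k \<phi> x * mu k x)
     = (\<Sum>x\<in>Q k. exp (\<phi> x) * mu k x) / (\<Sum>x\<in>Q k. exp (\<phi> x) * mu k x)"
    unfolding sum_divide_distrib by (intro sum.cong refl) (simp add: exp_density_def)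
  then show ?thesis using partition_function_pos[of \<phi> k] by simp
qed

lemma likelihood_bdd_above:
  fixes n :: nat
  shows "bdd_above ((\<lambda>p. \<Prod>i=1..n. p (x i)) ` exp_family k B)"
proof (rule bdd_aboveI2)
  fix p assume "p \<in> exp_family k B"
  then have "0 \<le> p y \<and> p y \<le> 2 ^ k" for y
    by (auto simp: exp_family_def exp_density_nonneg exp_density_le)
  then have "(\<Prod>i=1..n. p (x i)) \<le> (\<Prod>i=1..n. 2 ^ k)" by (intro prod_mono) auto
  then show "(\<Prod>i=1..n. p (x i)) \<le> (2 ^ k) ^ n" by simp
qed

section \<open>Existence of the maximum likelihood estimator for a given sample\<close>

text \<open>
  If \<open>\<psi> \<ge> 0\<close> vanishes on the sample but not on the cube, then passing from \<open>\<phi>\<close> to \<open>\<phi> - \<psi>\<close>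
  leaves \<open>exp \<phi>\<close> unchanged at the sample points and makes the normalising sum smaller. Hence no
  member of the family has maximal likelihood: every likelihood can still be increased strictly.
\<close>

lemma MLE_not_exists_if_nonneg_direction_missed:
  assumes diff: "\<And>\<phi>. \<phi> \<in> B \<Longrightarrow> (\<lambda>y. \<phi> y - \<psi> y) \<in> B"
    and nonneg: "\<And>y. y \<in> Q k \<Longrightarrow> \<psi> y \<ge> 0"
    and nonzero: "z \<in> Q k" "\<psi> z > 0"
    and sample: "\<And>i. i \<in> {1..n} \<Longrightarrow> x i \<in> Q k \<and> \<psi> (x i) = 0"
    and "n > 0"
  shows "\<not> MLE_exists k B n x"
proof
  assume "MLE_exists k B n x"
  then obtain \<phi> where \<phi>: "\<phi> \<in> B" and max:
    "(\<Prod>i=1..n. exp_density k \<phi> (x i)) = (SUP p\<in>exp_family k B. \<Prod>i=1..n. p (x i))"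
    by (auto simp: MLE_exists_def is_MLE_def exp_family_def)
  let ?\<phi>' = "\<lambda>y. \<phi> y - \<psi> y"
  have "(\<Sum>y\<in>Q k. exp (?\<phi>' y) * mu k y) < (\<Sum>y\<in>Q k. exp (\<phi> y) * mu k y)"
    by (rule sum_strict_mono_ex1) (use nonneg nonzero in \<open>auto simp: mu_def divide_simps intro!: bexI[of _ z]\<close>)
  then have less: "exp_density k \<phi> (x i) < exp_density k ?\<phi>' (x i)" if "i \<in> {1..n}" for i
    using sample[OF that] partition_function_pos[of ?\<phi>' k]
    by (simp add: exp_density_def divide_strict_left_mono)
  have "(\<Prod>i=1..n. exp_density k \<phi> (x i)) < (\<Prod>i=1..n. exp_density k ?\<phi>' (x i))"
    by (rule prod_mono_strict) (use less less_imp_le[OF less] exp_density_nonneg \<open>n > 0\<close> sample exp_density_pos in auto)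
  also have "\<dots> \<le> (SUP p\<in>exp_family k B. \<Prod>i=1..n. p (x i))"
    by (rule cSUP_upper[OF _ likelihood_bdd_above]) (use diff[OF \<phi>] in \<open>auto simp: exp_family_def\<close>)
  finally show False using max by simp
qed

text \<open>
  The members of the exponential family that are bounded below by \<open>m\<close>, written so that
  compactness is visible: bounds on every value and finitely many continuous equations, the last of
  which say that \<open>ln p\<close> has no high Fourier coefficients.
\<close>

definition densities_ge :: "nat \<Rightarrow> nat \<Rightarrow> real \<Rightarrow> ((nat \<Rightarrow> real) \<Rightarrow> real) set" where
  "densities_ge k d m = {p. (\<forall>x. p x \<in> (if x \<in> Q k then {m..2 ^ k} else {0})) \<and>
     (\<Sum>x\<in>Q k. p x * mu k x) = 1 \<and>
     (\<forall>T. T \<subseteq> {1..k} \<and> card T > d \<longrightarrow> (\<Sum>x\<in>Q k. ln (p x) * (\<Prod>i\<in>T. x i)) = 0)}"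

lemma compact_densities_ge:
  assumes "m > 0"
  shows "compact (densities_ge k d m)"
proof -
  define K where "K = {p :: (nat \<Rightarrow> real) \<Rightarrow> real. \<forall>x. p x \<in> (if x \<in> Q k then {m..2 ^ k} else {0})}"
  define R :: "(nat \<Rightarrow> real) \<Rightarrow> real set" where "R x = (if x \<in> Q k then {m..2 ^ k} else {0})" for x
  have "K = PiE UNIV R"
    by (simp add: K_def R_def PiE_UNIV_domain Pi_def)
  moreover have "compactin (product_topology (\<lambda>_. euclidean) UNIV) (PiE UNIV R)"
    unfolding compactin_PiE by (simp add: R_def)
  ultimately have "compact K"
    by (simp only: euclidean_product_topology compactin_euclidean_iff)
  have coord: "continuous_on S (\<lambda>p :: (nat \<Rightarrow> real) \<Rightarrow> real. p x)" for x S
    by (rule continuous_on_subset[OF continuous_on_product_coordinates subset_UNIV])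
  have "closedin (product_topology (\<lambda>_. euclidean) UNIV) (PiE UNIV R)"
    unfolding closedin_product_topology by (simp add: R_def)
  with \<open>K = PiE UNIV R\<close> have closed_K: "closed K"
    by (simp only: euclidean_product_topology closed_closedin)
  have "continuous_on K (\<lambda>p. \<Sum>x\<in>Q k. p x * mu k x)"
    by (intro continuous_on_sum continuous_on_mult coord continuous_on_const)
  from continuous_closed_preimage_constant[OF this closed_K]
  have "closed {p \<in> K. (\<Sum>x\<in>Q k. p x * mu k x) = 1}" .
  moreover have "closed {p \<in> K. (\<Sum>x\<in>Q k. ln (p x) * (\<Prod>i\<in>T. x i)) = 0}" for T
  proof -
    have "p x \<noteq> 0" if "p \<in> K" "x \<in> Q k" for p x
    proof -
      have "p x \<in> (if x \<in> Q k then {m..2 ^ k} else {0})" using that(1) unfolding K_def by blast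
      then show ?thesis using that(2) \<open>m > 0\<close> by simp
    qed
    then have "continuous_on K (\<lambda>p. \<Sum>x\<in>Q k. ln (p x) * (\<Prod>i\<in>T. x i))"
      by (intro continuous_on_sum continuous_on_mult continuous_on_ln coord continuous_on_const) blast
    from continuous_closed_preimage_constant[OF this closed_K] show ?thesis .
  qed
  ultimately have "compact (K \<inter> {p \<in> K. (\<Sum>x\<in>Q k. p x * mu k x) = 1} \<inter>
      (\<Inter>T\<in>{T. T \<subseteq> {1..k} \<and> card T > d}. {p \<in> K. (\<Sum>x\<in>Q k. ln (p x) * (\<Prod>i\<in>T. x i)) = 0}))"
    using \<open>compact K\<close> by (intro compact_Int_closed closed_INT) auto
  also have "\<dots> = densities_ge k d m"
    unfolding K_def densities_ge_def by blast
  finally show ?thesis .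
qed

text \<open>
  A normalised density is \<open>exp_density\<close> of its own logarithm. Conversely, the logarithm of a member
  of the family differs from a function in the space by the constant \<open>ln Z\<close>, where \<open>Z\<close> is the
  normalising sum, and constants lie in the space.
\<close>

lemma densities_ge_eq:
  assumes "m > 0"
  shows "densities_ge k d m = {p \<in> exp_family k (walsh_space k d). \<forall>x\<in>Q k. p x \<ge> m}"
proof (intro equalityI subsetI)
  fix p assume p: "p \<in> densities_ge k d m"
  define \<phi> where "\<phi> x = (if x \<in> Q k then ln (p x) else 0)" for x
  have "\<phi> \<in> walsh_space k d"
    using p by (simp add: walsh_space_iff \<phi>_def densities_ge_def)
  have pos: "p x > 0" if "x \<in> Q k" for x
    using p that assms by (force simp: densities_ge_def dest: spec[of _ x])
  have "(\<Sum>y\<in>Q k. exp (\<phi> y) * mu k y) = (\<Sum>y\<in>Q k. p y * mu k y)"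
    by (intro sum.cong refl) (simp add: \<phi>_def pos)
  then have "exp_density k \<phi> x = p x" for x
    using p pos[of x] by (auto simp: exp_density_def \<phi>_def densities_ge_def dest: spec[of _ x])
  then have "p = exp_density k \<phi>" by auto
  then show "p \<in> {p \<in> exp_family k (walsh_space k d). \<forall>x\<in>Q k. p x \<ge> m}"
    using \<open>\<phi> \<in> walsh_space k d\<close> p
    by (auto simp: exp_family_def densities_ge_def split: if_splits)
next
  fix p assume "p \<in> {p \<in> exp_family k (walsh_space k d). \<forall>x\<in>Q k. p x \<ge> m}"
  then obtain \<phi> where \<phi>: "\<phi> \<in> walsh_space k d" and p: "p = exp_density k \<phi>" and
    ge: "\<And>x. x \<in> Q k \<Longrightarrow> p x \<ge> m"
    by (auto simp: exp_family_def)
  let ?Z = "\<Sum>y\<in>Q k. exp (\<phi> y) * mu k y"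
  have "(\<lambda>x. \<phi> x - (if x \<in> Q k then ln ?Z else 0)) \<in> walsh_space k d"
    by (intro walsh_space_diff \<phi> constant_in_walsh_space)
  then have "(\<Sum>x\<in>Q k. (\<phi> x - (if x \<in> Q k then ln ?Z else 0)) * (\<Prod>i\<in>T. x i)) = 0"
    if "T \<subseteq> {1..k}" "card T > d" for T
    using that unfolding walsh_space_iff by blast
  moreover have "(\<Sum>x\<in>Q k. ln (p x) * w x) = (\<Sum>x\<in>Q k. (\<phi> x - (if x \<in> Q k then ln ?Z else 0)) * w x)" for w
    by (intro sum.cong refl) (use partition_function_pos[of \<phi> k] in \<open>simp add: p exp_density_def ln_div\<close>)
  ultimately show "p \<in> densities_ge k d m"
    using ge exp_density_le[of k \<phi>] exp_density_normalized[of k \<phi>]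
    by (simp add: densities_ge_def p) (simp add: exp_density_def)
qed

lemma exp_density_zero: "x \<in> Q k \<Longrightarrow> exp_density k (\<lambda>_. 0) x = 1"
  by (simp add: exp_density_def mu_def card_Q)

text \<open>
  The uniform density has likelihood \<open>1\<close>, so only densities with likelihood at least \<open>1\<close> compete for
  the maximum. Each factor of a likelihood is at most \<open>2 ^ k\<close>; since every point of the cube occurs
  in the sample, such a density is at least \<open>1 / (2 ^ k) ^ n\<close> everywhere. On the densities with this
  lower bound, a compact set, the likelihood attains its maximum.
\<close>

lemma MLE_exists_if_all_points_sampled:
  assumes "Q k \<subseteq> x ` {1..n}" "x ` {1..n} \<subseteq> Q k"
  shows "MLE_exists k (walsh_space k d) n x"
proof -
  let ?L = "\<lambda>p :: (nat \<Rightarrow> real) \<Rightarrow> real. \<Prod>i=1..n. p (x i)"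
  define m :: real where "m = 1 / (2 ^ k) ^ n"
  define F where "F = densities_ge k d m"
  have "m > 0" by (simp add: m_def)
  have "m \<le> 1" by (simp add: m_def one_le_power)
  have F: "F = {p \<in> exp_family k (walsh_space k d). \<forall>x\<in>Q k. p x \<ge> m}"
    unfolding F_def by (rule densities_ge_eq) fact
  let ?u = "exp_density k (\<lambda>_. 0)"
  have "(\<lambda>_. 0) \<in> walsh_space k d"
    using constant_in_walsh_space[of k 0 d] by simp
  then have u: "?u \<in> F"
    using \<open>m \<le> 1\<close> by (auto simp: F exp_family_def exp_density_zero)
  have Lu: "?L ?u = 1"
    using assms(2) by (intro prod.neutral) (auto simp: exp_density_zero)
  have "continuous_on F ?L"
    by (intro continuous_intros continuous_on_subset[OF continuous_on_product_coordinates]) auto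
  then obtain p where p: "p \<in> F" "\<And>p'. p' \<in> F \<Longrightarrow> ?L p' \<le> ?L p"
    using continuous_attains_sup[of F ?L] compact_densities_ge[OF \<open>m > 0\<close>] u
    unfolding F_def by blast
  have "?L p' \<le> ?L p" if p': "p' \<in> exp_family k (walsh_space k d)" for p'
  proof (cases "?L p' \<ge> 1")
    case False
    then show ?thesis using p(2)[OF u] Lu by simp
  next
    case True
    obtain \<phi> where \<phi>: "p' = exp_density k \<phi>" using p' by (auto simp: exp_family_def)
    have "p' y \<ge> m" if y: "y \<in> Q k" for y
    proof -
      obtain j where j: "j \<in> {1..n}" "y = x j" using assms(1) y by blast
      have "?L p' = p' y * (\<Prod>i\<in>{1..n}-{j}. p' (x i))"
        using j by (simp add: prod.remove)
      also have "\<dots> \<le> p' y * (\<Prod>i\<in>{1..n}-{j}. 2 ^ k)"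
        by (intro mult_left_mono prod_mono) (auto simp: \<phi> exp_density_nonneg exp_density_le)
      also have "\<dots> \<le> p' y * (2 ^ k) ^ n"
        using j by (auto simp: \<phi> exp_density_nonneg intro!: mult_left_mono power_increasing)
      finally show ?thesis using True by (simp add: m_def field_simps)
    qed
    then show ?thesis using p' by (intro p(2)) (simp add: F)
  qed
  then have "(SUP p'\<in>exp_family k (walsh_space k d). ?L p') = ?L p"
    using p(1) by (intro cSup_eq_maximum) (auto simp: F)
  then show ?thesis using p(1) by (auto simp: MLE_exists_def is_MLE_def F)
qed

section \<open>Disjoint subcubes\<close>

lemma subcube_as_PiE:
  assumes "y \<in> Q k" "d \<le> k"
  shows "{x \<in> Q k. \<forall>i\<in>{1..d}. x i = y i} = PiE {1..k} (\<lambda>i. if i \<le> d then {y i} else {-1, 1})"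
proof (intro equalityI subsetI)
  fix x assume x: "x \<in> {x \<in> Q k. \<forall>i\<in>{1..d}. x i = y i}"
  then have "x i \<in> (if i \<le> d then {y i} else {-1, 1})" if "i \<in> {1..k}" for i
    using that Q_coordinate[of x k i] by auto
  moreover have "x \<in> extensional {1..k}"
    using x by (simp add: Q_def PiE_def)
  ultimately show "x \<in> PiE {1..k} (\<lambda>i. if i \<le> d then {y i} else {-1, 1})"
    by (intro PiE_I) (auto simp: extensional_def)
next
  fix x assume x: "x \<in> PiE {1..k} (\<lambda>i. if i \<le> d then {y i} else {-1, 1})"
  have mem: "x i \<in> (if i \<le> d then {y i} else {-1, 1})" if "i \<in> {1..k}" for i
    using PiE_mem[OF x that] .
  have "x \<in> Q k"
    unfolding Q_def
  proof (rule PiE_I)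
    fix i assume i: "i \<in> {1..k}"
    then show "x i \<in> {-1, 1}"
      using mem[OF i] Q_coordinate[OF assms(1) i] by (simp split: if_splits)
  qed (use x in \<open>rule PiE_arb\<close>)
  moreover have "x i = y i" if "i \<in> {1..d}" for i
    using mem[of i] that assms(2) by simp
  ultimately show "x \<in> {x \<in> Q k. \<forall>i\<in>{1..d}. x i = y i}" by simp
qed

lemma card_subcube:
  assumes "y \<in> Q k" "d \<le> k"
  shows "card {x \<in> Q k. \<forall>i\<in>{1..d}. x i = y i} = 2 ^ (k - d)"
proof -
  have "card {x \<in> Q k. \<forall>i\<in>{1..d}. x i = y i}
      = (\<Prod>i\<in>{1..k}. card (if i \<le> d then {y i} else {-1, 1}))"
    unfolding subcube_as_PiE[OF assms] by (rule card_PiE) simp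
  also have "\<dots> = (\<Prod>i\<in>{1..k}. if i \<le> d then 1 else 2)"
    by (intro prod.cong refl) (simp add: numeral_2_eq_2)
  also have "\<dots> = (\<Prod>i\<in>{Suc d..k}. 2)"
    by (intro prod.mono_neutral_cong_right) auto
  also have "\<dots> = 2 ^ (k - d)" by simp
  finally show ?thesis .
qed

text \<open>
  Fixing the first \<open>d\<close> coordinates partitions the cube into \<open>2 ^ d\<close> subcubes of dimension
  \<open>k - d\<close>. They are indexed here by the point of each of them whose remaining coordinates are all
  \<open>1\<close>, so that the index set lies in the cube.
\<close>

definition subcube_corners :: "nat \<Rightarrow> nat \<Rightarrow> (nat \<Rightarrow> real) set" where
  "subcube_corners k d = PiE {1..k} (\<lambda>i. if i \<le> d then {-1, 1} else {1})"

lemma subcube_corners_subset: "subcube_corners k d \<subseteq> Q k"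
  unfolding subcube_corners_def Q_def by (rule PiE_mono) auto

lemma card_subcube_corners:
  assumes "d \<le> k"
  shows "card (subcube_corners k d) = 2 ^ d"
proof -
  have "card (subcube_corners k d) = (\<Prod>i\<in>{1..k}. card (if i \<le> d then {-1, 1::real} else {1}))"
    unfolding subcube_corners_def by (rule card_PiE) simp
  also have "\<dots> = (\<Prod>i\<in>{1..k}. if i \<le> d then 2 else 1)"
    by (intro prod.cong refl) (simp add: numeral_2_eq_2)
  also have "\<dots> = (\<Prod>i\<in>{1..d}. 2)"
    using assms by (intro prod.mono_neutral_cong_right) auto
  also have "\<dots> = 2 ^ d" by simp
  finally show ?thesis .
qed

lemma subcubes_disjoint:
  assumes "y \<in> subcube_corners k d" "z \<in> subcube_corners k d" "y \<noteq> z"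
  shows "{x \<in> Q k. \<forall>i\<in>{1..d}. x i = y i} \<inter> {x \<in> Q k. \<forall>i\<in>{1..d}. x i = z i} = {}"
proof (rule ccontr)
  assume "\<not> ?thesis"
  then obtain x where x: "\<And>i. i \<in> {1..d} \<Longrightarrow> x i = y i" "\<And>i. i \<in> {1..d} \<Longrightarrow> x i = z i"
    by blast
  have "y i = z i" if i: "i \<in> {1..k}" for i
  proof (cases "i \<le> d")
    case True
    then show ?thesis using x[of i] i by simp
  next
    case False
    then show ?thesis
      using PiE_mem[OF assms(1)[unfolded subcube_corners_def] i]
        PiE_mem[OF assms(2)[unfolded subcube_corners_def] i] by simp
  qed
  then have "y = z"
    using assms(1,2) subcube_corners_subset[of k d] by (intro Q_eqI[of y k z]) auto
  then show False using assms(3) by simp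
qed

section \<open>Probability bounds\<close>

context prob_space begin

text \<open>
  Chebyshev's inequality for the number \<open>f\<close> of events that occur. Nonpositive correlation of
  distinct events bounds the variance of \<open>f\<close> by its mean \<open>m\<close>, so \<open>f = 0\<close> has probability at most
  \<open>m / m\<^sup>2\<close>.
\<close>

lemma second_moment_bound:
  fixes E :: "'b \<Rightarrow> 'a set"
  assumes I: "finite I" "I \<noteq> {}" and "p > 0"
    and E: "\<And>y. y \<in> I \<Longrightarrow> E y \<in> events" "\<And>y. y \<in> I \<Longrightarrow> prob (E y) = p"
    and pair: "\<And>y z. y \<in> I \<Longrightarrow> z \<in> I \<Longrightarrow> y \<noteq> z \<Longrightarrow> prob (E y \<inter> E z) \<le> p\<^sup>2"
  shows "prob (space M - (\<Union>y\<in>I. E y)) \<le> 1 / (real (card I) * p)"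
proof -
  define f :: "'a \<Rightarrow> real" where "f \<omega> = (\<Sum>y\<in>I. indicat_real (E y) \<omega>)" for \<omega>
  define m where "m = real (card I) * p"
  have "m > 0" using I \<open>p > 0\<close> by (simp add: m_def card_gt_0_iff)
  have int: "integrable M (indicat_real A)" if "A \<in> events" for A
    using that by (intro integrable_real_indicator) (auto simp: emeasure_eq_measure)
  have Ef: "expectation f = m"
    unfolding f_def using E int by (subst Bochner_Integration.integral_sum) (auto simp: m_def)
  have f2: "(f \<omega>)\<^sup>2 = (\<Sum>y\<in>I. \<Sum>z\<in>I. indicat_real (E y \<inter> E z) \<omega>)" for \<omega>
    by (simp add: f_def power2_eq_square sum_product indicator_inter_arith)
  have meas: "E y \<inter> E z \<in> events" if "y \<in> I" "z \<in> I" for y z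
    using E that by auto
  have int2: "integrable M (\<lambda>\<omega>. (f \<omega>)\<^sup>2)"
    unfolding f2 by (intro Bochner_Integration.integrable_sum int meas)
  have int1: "integrable M f"
    unfolding f_def by (intro Bochner_Integration.integrable_sum int E)
  have "expectation (\<lambda>\<omega>. (f \<omega>)\<^sup>2) = (\<Sum>y\<in>I. \<Sum>z\<in>I. prob (E y \<inter> E z))"
  proof -
    have "expectation (\<lambda>\<omega>. (f \<omega>)\<^sup>2) = (\<Sum>y\<in>I. expectation (\<lambda>\<omega>. \<Sum>z\<in>I. indicat_real (E y \<inter> E z) \<omega>))"
      unfolding f2 by (intro Bochner_Integration.integral_sum Bochner_Integration.integrable_sum int meas)
    also have "\<dots> = (\<Sum>y\<in>I. \<Sum>z\<in>I. expectation (indicat_real (E y \<inter> E z)))"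
      by (intro sum.cong refl Bochner_Integration.integral_sum int meas)
    also have "\<dots> = (\<Sum>y\<in>I. \<Sum>z\<in>I. prob (E y \<inter> E z))"
      by (intro sum.cong refl) (use meas in simp)
    finally show ?thesis .
  qed
  also have "\<dots> \<le> (\<Sum>y\<in>I. \<Sum>z\<in>I. (if y = z then p else 0) + p\<^sup>2)"
    by (intro sum_mono) (use pair E \<open>p > 0\<close> in auto)
  also have "\<dots> = m + m\<^sup>2"
    using I by (simp add: sum.distrib m_def power2_eq_square algebra_simps)
  finally have var: "variance f \<le> m"
    using variance_eq[OF int1 int2] Ef by simp
  have "prob (space M - (\<Union>y\<in>I. E y)) \<le> prob {\<omega> \<in> space M. \<bar>f \<omega> - expectation f\<bar> \<ge> m}"
  proof (rule finite_measure_mono)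
    show "space M - (\<Union>y\<in>I. E y) \<subseteq> {\<omega> \<in> space M. \<bar>f \<omega> - expectation f\<bar> \<ge> m}"
    proof
      fix \<omega> assume "\<omega> \<in> space M - (\<Union>y\<in>I. E y)"
      moreover from this have "f \<omega> = 0" unfolding f_def by (intro sum.neutral) auto
      ultimately show "\<omega> \<in> {\<omega> \<in> space M. \<bar>f \<omega> - expectation f\<bar> \<ge> m}"
        using Ef \<open>m > 0\<close> by simp
    qed
    have "f \<in> borel_measurable M" using int1 by (rule borel_measurable_integrable)
    then show "{\<omega> \<in> space M. \<bar>f \<omega> - expectation f\<bar> \<ge> m} \<in> events" by measurable
  qed
  also have "\<dots> \<le> variance f / m\<^sup>2"
    by (rule Chebyshev_inequality) (use int1 int2 \<open>m > 0\<close> in auto)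
  also have "\<dots> \<le> m / m\<^sup>2" using var by (rule divide_right_mono) simp
  also have "\<dots> = 1 / m" using \<open>m > 0\<close> by (simp add: power2_eq_square)
  finally show ?thesis by (simp add: m_def)
qed

lemma iid_uniform_measurable:
  assumes "iid_uniform M k n X" "i \<in> {1..n}"
  shows "X i \<in> measurable M (count_space (Q k))"
  using assms by (auto simp: iid_uniform_def indep_vars_def)

lemma iid_uniform_sample_in_Q:
  assumes "iid_uniform M k n X" "i \<in> {1..n}" "\<omega> \<in> space M"
  shows "X i \<omega> \<in> Q k"
  using measurable_space[OF iid_uniform_measurable[OF assms(1,2)] assms(3)] by simp

definition sample_avoids :: "nat \<Rightarrow> (nat \<Rightarrow> 'a \<Rightarrow> nat \<Rightarrow> real) \<Rightarrow> (nat \<Rightarrow> real) set \<Rightarrow> 'a set" where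
  "sample_avoids n X A = {\<omega> \<in> space M. \<forall>i\<in>{1..n}. X i \<omega> \<notin> A}"

lemma
  assumes iid: "iid_uniform M k n X" and "n > 0" and A: "A \<subseteq> Q k"
  shows sample_avoids_measurable: "sample_avoids n X A \<in> events"
    and prob_sample_avoids: "prob (sample_avoids n X A) = (1 - real (card A) / 2 ^ k) ^ n"
proof -
  have eq: "sample_avoids n X A = (\<Inter>i\<in>{1..n}. X i -` (Q k - A) \<inter> space M)"
    using iid_uniform_sample_in_Q[OF iid] \<open>n > 0\<close> unfolding sample_avoids_def by fastforce
  have sets: "X i -` (Q k - A) \<inter> space M \<in> events" if "i \<in> {1..n}" for i
    by (rule measurable_sets[OF iid_uniform_measurable[OF iid that]]) simp
  then show "sample_avoids n X A \<in> events"
    unfolding eq using \<open>n > 0\<close> by (intro sets.finite_INT) auto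
  have "prob (X i -` (Q k - A) \<inter> space M) = 1 - real (card A) / 2 ^ k" if i: "i \<in> {1..n}" for i
  proof -
    have "prob (X i -` (Q k - A) \<inter> space M) = measure (distr M (count_space (Q k)) (X i)) (Q k - A)"
      by (rule measure_distr[symmetric]) (use iid_uniform_measurable[OF iid i] in auto)
    also have "\<dots> = measure (uniform_count_measure (Q k)) (Q k - A)"
      using iid i unfolding iid_uniform_def by simp
    also have "\<dots> = real (card (Q k - A)) / card (Q k)"
      by (rule measure_uniform_count_measure) auto
    also have "\<dots> = 1 - real (card A) / 2 ^ k"
      using A card_mono[OF finite_Q A] finite_subset[OF A]
      by (simp add: card_Diff_subset card_Q of_nat_diff diff_divide_distrib)
    finally show ?thesis .
  qed
  moreover have "prob (\<Inter>i\<in>{1..n}. X i -` (Q k - A) \<inter> space M)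
      = (\<Prod>i\<in>{1..n}. prob (X i -` (Q k - A) \<inter> space M))"
    using iid \<open>n > 0\<close> unfolding iid_uniform_def
    by (intro indep_varsD_finite[where M' = "\<lambda>_. count_space (Q k)"]) auto
  ultimately show "prob (sample_avoids n X A) = (1 - real (card A) / 2 ^ k) ^ n"
    unfolding eq by simp
qed

text \<open>
  A missed subcube of dimension \<open>q\<close> prevents the existence of the MLE, because its indicator is a
  nonnegative function in the space. A given subcube is missed with probability \<open>(1 - u) ^ n\<close>, where
  \<open>u\<close> is its proportion of the cube, and two disjoint ones with probability \<open>(1 - 2 * u) ^ n\<close>. Since
  \<open>1 - 2 * u \<le> (1 - u)\<^sup>2\<close>, the second moment bound applies to the \<open>2 ^ (k - q)\<close> disjoint subcubes.
\<close>

lemma prob_MLE_exists_le: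
  assumes iid: "iid_uniform M k n X" and "n > 0" and "q < k"
  shows "prob {\<omega> \<in> space M. MLE_exists k (walsh_space k (k - q)) n (\<lambda>i. X i \<omega>)}
    \<le> 1 / (2 ^ (k - q) * (1 - 2 ^ q / 2 ^ k) ^ n)"
proof -
  define d where "d = k - q"
  have d: "d \<le> k" "k - d = q" using \<open>q < k\<close> by (auto simp: d_def)
  define C where "C y = {x \<in> Q k. \<forall>i\<in>{1..d}. x i = y i}" for y :: "nat \<Rightarrow> real"
  let ?I = "subcube_corners k d"
  let ?u = "(2 :: real) ^ q / 2 ^ k"
  have I: "y \<in> Q k" if "y \<in> ?I" for y using that subcube_corners_subset by blast
  have card_I: "card ?I = 2 ^ d" by (rule card_subcube_corners) (rule d)
  have C: "C y \<subseteq> Q k" for y by (auto simp: C_def)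
  have card_C: "card (C y) = 2 ^ q" if "y \<in> ?I" for y
    unfolding C_def using card_subcube[OF I[OF that] d(1)] d(2) by simp
  have "?u < 1" using \<open>q < k\<close> by simp
  have "prob {\<omega> \<in> space M. MLE_exists k (walsh_space k d) n (\<lambda>i. X i \<omega>)}
      \<le> prob (space M - (\<Union>y\<in>?I. sample_avoids n X (C y)))"
  proof (rule finite_measure_mono)
    show "space M - (\<Union>y\<in>?I. sample_avoids n X (C y)) \<in> events"
      by (intro sets.Diff sets.top sets.finite_UN sample_avoids_measurable[OF iid \<open>n > 0\<close> C]
          finite_subset[OF subcube_corners_subset finite_Q])
    have "\<not> MLE_exists k (walsh_space k d) n (\<lambda>i. X i \<omega>)"
      if y: "y \<in> ?I" and avoid: "\<omega> \<in> sample_avoids n X (C y)" for y \<omega>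
    proof (rule MLE_not_exists_if_nonneg_direction_missed)
      let ?\<psi> = "\<lambda>x. if x \<in> Q k \<and> (\<forall>i\<in>{1..d}. x i = y i) then 1 else 0 :: real"
      show "(\<lambda>x. \<phi> x - ?\<psi> x) \<in> walsh_space k d" if "\<phi> \<in> walsh_space k d" for \<phi>
        using that I[OF y] d(1)
        by (intro walsh_space_diff subcube_indicator_in_walsh_space) auto
      show "y \<in> Q k" "?\<psi> y > 0" using I[OF y] by auto
      show "X i \<omega> \<in> Q k \<and> ?\<psi> (X i \<omega>) = 0" if "i \<in> {1..n}" for i
      proof -
        have "\<omega> \<in> space M" "X i \<omega> \<notin> C y" using avoid that by (auto simp: sample_avoids_def)
        then show ?thesis using iid_uniform_sample_in_Q[OF iid that] by (simp add: C_def)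
      qed
    qed (use \<open>n > 0\<close> in auto)
    then show "{\<omega> \<in> space M. MLE_exists k (walsh_space k d) n (\<lambda>i. X i \<omega>)}
        \<subseteq> space M - (\<Union>y\<in>?I. sample_avoids n X (C y))" by blast
  qed
  also have "\<dots> \<le> 1 / (real (card ?I) * (1 - ?u) ^ n)"
  proof (rule second_moment_bound)
    show "finite ?I" by (rule finite_subset[OF subcube_corners_subset finite_Q])
    show "?I \<noteq> {}" using card_I by force
    show "0 < (1 - ?u) ^ n" using \<open>?u < 1\<close> by simp
    show "sample_avoids n X (C y) \<in> events" for y
      by (rule sample_avoids_measurable[OF iid \<open>n > 0\<close> C])
    show "prob (sample_avoids n X (C y)) = (1 - ?u) ^ n" if "y \<in> ?I" for y
      using prob_sample_avoids[OF iid \<open>n > 0\<close> C] card_C[OF that] by simp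
  next
    fix y z assume yz: "y \<in> ?I" "z \<in> ?I" "y \<noteq> z"
    have "C y \<inter> C z = {}" unfolding C_def by (rule subcubes_disjoint[OF yz])
    then have card_union: "card (C y \<union> C z) = 2 * 2 ^ q"
      using card_C yz by (subst card_Un_disjoint) (auto intro: finite_subset[OF C finite_Q])
    have "C y \<union> C z \<subseteq> Q k" using C by blast
    then have "card (C y \<union> C z) \<le> card (Q k)" by (rule card_mono[OF finite_Q])
    then have "real (2 * 2 ^ q) \<le> real (2 ^ k)" unfolding card_union card_Q of_nat_le_iff .
    then have "2 * ?u \<le> 1" by simp
    have "sample_avoids n X (C y) \<inter> sample_avoids n X (C z) = sample_avoids n X (C y \<union> C z)"
      by (auto simp: sample_avoids_def)
    then have "prob (sample_avoids n X (C y) \<inter> sample_avoids n X (C z)) = (1 - 2 * ?u) ^ n"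
      using prob_sample_avoids[OF iid \<open>n > 0\<close> \<open>C y \<union> C z \<subseteq> Q k\<close>] card_union by simp
    also have "\<dots> \<le> ((1 - ?u)\<^sup>2) ^ n"
    proof (rule power_mono)
      show "1 - 2 * ?u \<le> (1 - ?u)\<^sup>2"
        using zero_le_power2[of ?u] unfolding power2_diff by simp
    qed (use \<open>2 * ?u \<le> 1\<close> in simp)
    also have "\<dots> = ((1 - ?u) ^ n)\<^sup>2" by (simp only: power_mult[symmetric] mult.commute)
    finally show "prob (sample_avoids n X (C y) \<inter> sample_avoids n X (C z)) \<le> ((1 - ?u) ^ n)\<^sup>2" .
  qed
  finally show ?thesis unfolding card_I by (simp add: d_def)
qed

lemma MLE_exists_cong:
  assumes "\<And>i. i \<in> {1..n} \<Longrightarrow> x i = y i"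
  shows "MLE_exists k B n x \<longleftrightarrow> MLE_exists k B n y"
proof -
  have "(\<Prod>i=1..n. p (x i)) = (\<Prod>i=1..n. p (y i))" for p :: "(nat \<Rightarrow> real) \<Rightarrow> real"
    using assms by (intro prod.cong) auto
  then show ?thesis by (simp add: MLE_exists_def is_MLE_def)
qed

text \<open>
  The sample takes finitely many values, and the event is a finite union of the events that the
  sample has a given value. The observations at indices outside \<open>{1..n}\<close> are arbitrary functions of
  \<open>\<omega>\<close>, so a value means a function restricted to \<open>{1..n}\<close>.
\<close>

lemma MLE_exists_measurable:
  assumes iid: "iid_uniform M k n X" and "n > 0"
  shows "{\<omega> \<in> space M. MLE_exists k B n (\<lambda>i. X i \<omega>)} \<in> events"
proof -
  define Y where "Y = {y \<in> PiE {1..n} (\<lambda>_. Q k). MLE_exists k B n y}"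
  define E where "E y = (\<Inter>i\<in>{1..n}. X i -` {y i} \<inter> space M)" for y
  have "finite Y" unfolding Y_def
    by (rule finite_subset[of _ "PiE {1..n} (\<lambda>_. Q k)"]) (blast, intro finite_PiE, simp_all)
  have "E y \<in> events" if "y \<in> Y" for y
  proof -
    have "X i -` {y i} \<inter> space M \<in> events" if i: "i \<in> {1..n}" for i
      using \<open>y \<in> Y\<close> i
      by (intro measurable_sets[OF iid_uniform_measurable[OF iid i]]) (auto simp: Y_def)
    then show ?thesis unfolding E_def using \<open>n > 0\<close> by (intro sets.finite_INT) auto
  qed
  then have "(\<Union>y\<in>Y. E y) \<in> events" using \<open>finite Y\<close> by (intro sets.finite_UN) auto
  also have "(\<Union>y\<in>Y. E y) = {\<omega> \<in> space M. MLE_exists k B n (\<lambda>i. X i \<omega>)}"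
  proof (intro equalityI subsetI)
    fix \<omega> assume "\<omega> \<in> (\<Union>y\<in>Y. E y)"
    then obtain y where y: "y \<in> Y" "\<omega> \<in> E y" by blast
    then have "\<And>i. i \<in> {1..n} \<Longrightarrow> X i \<omega> = y i" by (auto simp: E_def)
    then have "MLE_exists k B n (\<lambda>i. X i \<omega>)"
      using MLE_exists_cong[of n "\<lambda>i. X i \<omega>" y k B] y(1) by (simp add: Y_def)
    moreover have "\<omega> \<in> space M" using y(2) \<open>n > 0\<close> by (force simp: E_def)
    ultimately show "\<omega> \<in> {\<omega> \<in> space M. MLE_exists k B n (\<lambda>i. X i \<omega>)}" by simp
  next
    fix \<omega> assume \<omega>: "\<omega> \<in> {\<omega> \<in> space M. MLE_exists k B n (\<lambda>i. X i \<omega>)}"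
    let ?y = "restrict (\<lambda>i. X i \<omega>) {1..n}"
    have "MLE_exists k B n ?y"
      using \<omega> MLE_exists_cong[of n ?y "\<lambda>i. X i \<omega>" k B] by simp
    then have "?y \<in> Y"
      using \<omega> iid_uniform_sample_in_Q[OF iid] unfolding Y_def by auto
    moreover have "\<omega> \<in> E ?y" using \<omega> by (auto simp: E_def)
    ultimately show "\<omega> \<in> (\<Union>y\<in>Y. E y)" by blast
  qed
  finally show ?thesis .
qed

text \<open>
  Union bound over the points that the sample may miss, as in the coupon collector's problem.
\<close>

lemma prob_MLE_exists_ge:
  assumes iid: "iid_uniform M k n X" and "n > 0"
  shows "prob {\<omega> \<in> space M. MLE_exists k (walsh_space k d) n (\<lambda>i. X i \<omega>)}
    \<ge> 1 - 2 ^ k * (1 - 1 / 2 ^ k) ^ n"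
proof -
  let ?G = "{\<omega> \<in> space M. MLE_exists k (walsh_space k d) n (\<lambda>i. X i \<omega>)}"
  have G: "?G \<in> events" by (rule MLE_exists_measurable) fact+
  have single: "{y} \<subseteq> Q k" if "y \<in> Q k" for y using that by simp
  have "space M - ?G \<subseteq> (\<Union>y\<in>Q k. sample_avoids n X {y})"
  proof
    fix \<omega> assume \<omega>: "\<omega> \<in> space M - ?G"
    have "(\<lambda>i. X i \<omega>) ` {1..n} \<subseteq> Q k"
      using iid_uniform_sample_in_Q[OF iid] \<omega> by blast
    then have "\<not> Q k \<subseteq> (\<lambda>i. X i \<omega>) ` {1..n}"
      using MLE_exists_if_all_points_sampled[of k "\<lambda>i. X i \<omega>" n d] \<omega> by auto
    then show "\<omega> \<in> (\<Union>y\<in>Q k. sample_avoids n X {y})"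
      using \<omega> by (fastforce simp: sample_avoids_def)
  qed
  then have "prob (space M - ?G) \<le> prob (\<Union>y\<in>Q k. sample_avoids n X {y})"
    by (rule finite_measure_mono)
       (intro sets.finite_UN finite_Q sample_avoids_measurable[OF iid \<open>n > 0\<close> single])
  also have "\<dots> \<le> (\<Sum>y\<in>Q k. prob (sample_avoids n X {y}))"
    by (rule finite_measure_subadditive_finite)
       (auto intro!: sample_avoids_measurable[OF iid \<open>n > 0\<close> single])
  also have "\<dots> = (\<Sum>y\<in>Q k. (1 - 1 / 2 ^ k) ^ n)"
    by (intro sum.cong refl) (use prob_sample_avoids[OF iid \<open>n > 0\<close> single] in simp)
  also have "\<dots> = 2 ^ k * (1 - 1 / 2 ^ k) ^ n" by (simp add: card_Q)
  finally show ?thesis using prob_compl[OF G] by simp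
qed

end

section \<open>The threshold\<close>

lemma exp_le_one_minus_power:
  fixes u :: real
  assumes "0 \<le> u" "u \<le> 1 / 2"
  shows "exp (- (2 * u * real n)) \<le> (1 - u) ^ n"
proof -
  have "u\<^sup>2 \<le> u * (1 / 2)"
    unfolding power2_eq_square using assms by (intro mult_left_mono)
  then have "- (2 * u) \<le> ln (1 - u)"
    using ln_one_minus_pos_lower_bound[OF assms] by simp
  then have "exp (- (2 * u)) \<le> 1 - u"
    using assms by (simp add: ln_ge_iff)
  then have "exp (- (2 * u)) ^ n \<le> (1 - u) ^ n" by (rule power_mono) simp
  then show ?thesis by (simp add: exp_of_nat_mult[symmetric] mult_ac)
qed

lemma one_minus_power_le_exp:
  fixes u :: real
  assumes "u \<le> 1"
  shows "(1 - u) ^ n \<le> exp (- (u * real n))"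
proof -
  have "1 - u \<le> exp (- u)" using exp_ge_add_one_self[of "- u"] by simp
  then have "(1 - u) ^ n \<le> exp (- u) ^ n" using assms by (intro power_mono) auto
  then show ?thesis by (simp add: exp_of_nat_mult[symmetric] mult_ac)
qed

theorem lemma5p6:
  fixes q :: nat
    and n :: "nat \<Rightarrow> nat"
    and M :: "nat \<Rightarrow> 'a measure"
    and X :: "nat \<Rightarrow> nat \<Rightarrow> 'a \<Rightarrow> nat \<Rightarrow> real"
  assumes "q \<ge> 1"
    and "\<And>k. k > q \<Longrightarrow> n k > 0"
    and "\<And>k. k > q \<Longrightarrow> prob_space (M k)"
    and "\<And>k. k > q \<Longrightarrow> iid_uniform (M k) k (n k) (X k)"
  shows "((\<lambda>k. real (n k) / (real k * 2 ^ k)) \<longlonglongrightarrow> 0 \<longrightarrow>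
           (\<lambda>k. measure (M k) {\<omega> \<in> space (M k).
              MLE_exists k (walsh_space k (k - q)) (n k) (\<lambda>i. X k i \<omega>)}) \<longlonglongrightarrow> 0) \<and>
         (filterlim (\<lambda>k. real (n k) / (real k * 2 ^ k)) at_top sequentially \<longrightarrow>
           (\<lambda>k. measure (M k) {\<omega> \<in> space (M k).
              MLE_exists k (walsh_space k (k - q)) (n k) (\<lambda>i. X k i \<omega>)}) \<longlonglongrightarrow> 1)"
proof -
  define r where "r k = real (n k) / (real k * 2 ^ k)" for k
  define P where "P k = measure (M k) {\<omega> \<in> space (M k).
    MLE_exists k (walsh_space k (k - q)) (n k) (\<lambda>i. X k i \<omega>)}" for k
  have n_eq: "real (n k) / 2 ^ k = real k * r k" if "k > q" for k
    using that by (simp add: r_def)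
  have eventually_gt: "\<forall>\<^sub>F k in sequentially. k > q" by (rule eventually_gt_at_top)
  have "P \<longlonglongrightarrow> 0" if "r \<longlonglongrightarrow> 0"
  proof (rule tendsto_sandwich[of "\<lambda>_. 0" _ _ "\<lambda>k. 2 ^ q * exp (- (ln 2 / 2)) ^ k"])
    \<comment> \<open>The mean number of missed subcubes is at least a constant times
      \<open>exp (k * (ln 2 - 2 * 2 ^ q * r k))\<close>; this bound on \<open>r k\<close> gives away half of the exponent \<open>k * ln 2\<close>.\<close>
    have "\<forall>\<^sub>F k in sequentially. r k < ln 2 / 2 / (2 * 2 ^ q)"
      using that by (rule order_tendstoD(2)) simp
    then show "\<forall>\<^sub>F k in sequentially. P k \<le> 2 ^ q * exp (- (ln 2 / 2)) ^ k"
      using eventually_gt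
    proof eventually_elim
      case (elim k)
      let ?u = "(2 :: real) ^ q / 2 ^ k"
      have "(2 :: real) ^ Suc q \<le> 2 ^ k"
        by (rule power_increasing) (use elim(2) in auto)
      then have u: "0 \<le> ?u" "?u \<le> 1 / 2" by (simp_all add: field_simps)
      interpret prob_space "M k" by (rule assms(3)) (rule elim(2))
      have "2 * ?u * real (n k) = real k * (2 * 2 ^ q * r k)"
        using n_eq[OF elim(2)] by (simp add: field_simps)
      also have "\<dots> \<le> real k * (ln 2 / 2)"
        using elim(1) by (intro mult_left_mono) (auto simp: field_simps)
      finally have exponent: "2 * ?u * real (n k) \<le> real k * (ln 2 / 2)" .
      have "P k \<le> 1 / (2 ^ (k - q) * (1 - ?u) ^ n k)"
        unfolding P_def by (rule prob_MLE_exists_le[OF assms(4)[OF elim(2)] assms(2)[OF elim(2)] elim(2)])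
      also have "\<dots> \<le> 1 / (2 ^ (k - q) * exp (- (2 * ?u * real (n k))))"
        by (intro divide_left_mono mult_left_mono exp_le_one_minus_power u mult_pos_pos zero_less_power)
           (use u elim(2) in auto)
      also have "\<dots> = 2 ^ q / 2 ^ k * exp (2 * ?u * real (n k))"
        using elim(2) by (simp add: power_diff exp_minus field_simps)
      also have "\<dots> \<le> 2 ^ q / 2 ^ k * exp (real k * (ln 2 / 2))"
        using exponent by (intro mult_left_mono) auto
      also have "\<dots> = 2 ^ q * (exp (ln 2 / 2) / 2) ^ k"
        unfolding exp_of_nat_mult by (simp add: power_divide)
      also have "exp (ln 2 / 2) / 2 = exp (- (ln 2 / 2) :: real)"
      proof -
        have "exp (ln 2 / 2) / 2 = exp (ln 2 / 2 - ln 2 :: real)" by (subst exp_diff) simp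
        also have "ln 2 / 2 - ln 2 = (- (ln 2 / 2) :: real)" by simp
        finally show ?thesis .
      qed
      finally show ?case .
    qed
    have "(\<lambda>k. exp (- (ln 2 / 2) :: real) ^ k) \<longlonglongrightarrow> 0"
      by (rule LIMSEQ_realpow_zero) auto
    from tendsto_mult_right_zero[OF this]
    show "(\<lambda>k. 2 ^ q * exp (- (ln 2 / 2) :: real) ^ k) \<longlonglongrightarrow> 0" .
  qed (auto simp: P_def)
  moreover have "P \<longlonglongrightarrow> 1" if "filterlim r at_top sequentially"
  proof (rule tendsto_sandwich[of "\<lambda>k. 1 - exp (- 1) ^ k" _ _ "\<lambda>_. 1"])
    \<comment> \<open>The mean number of missed points is at most \<open>exp (k * (ln 2 - r k))\<close>, and \<open>ln 2 \<le> 1\<close>.\<close>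
    have "\<forall>\<^sub>F k in sequentially. r k \<ge> 2"
      using that unfolding filterlim_at_top by blast
    then show "\<forall>\<^sub>F k in sequentially. 1 - exp (- 1) ^ k \<le> P k"
      using eventually_gt
    proof eventually_elim
      case (elim k)
      interpret prob_space "M k" by (rule assms(3)) (rule elim(2))
      have "ln 2 \<le> (1 :: real)" using ln_le_minus_one[of "2 :: real"] by simp
      have "(1 - 1 / 2 ^ k :: real) ^ n k \<le> exp (- (1 / 2 ^ k * real (n k)))"
        by (rule one_minus_power_le_exp) simp
      also have "1 / 2 ^ k * real (n k) = real k * r k"
        using n_eq[OF elim(2)] by simp
      finally have "2 ^ k * (1 - 1 / 2 ^ k :: real) ^ n k \<le> 2 ^ k * exp (- (real k * r k))"
        by (rule mult_left_mono) simp
      also have "\<dots> = exp (real k * (ln 2 - r k))"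
      proof -
        have "(2 :: real) ^ k = exp (real k * ln 2)" by (simp add: exp_of_nat_mult)
        then show ?thesis by (simp add: exp_add[symmetric] algebra_simps)
      qed
      also have "\<dots> \<le> exp (real k * (- 1))"
        unfolding exp_le_cancel_iff
        using elim(1) \<open>ln 2 \<le> 1\<close> by (intro mult_left_mono) auto
      also have "\<dots> = exp (- 1) ^ k" by (rule exp_of_nat_mult)
      finally have "2 ^ k * (1 - 1 / 2 ^ k :: real) ^ n k \<le> exp (- 1) ^ k" .
      moreover have "P k \<ge> 1 - 2 ^ k * (1 - 1 / 2 ^ k) ^ n k"
        unfolding P_def by (rule prob_MLE_exists_ge[OF assms(4)[OF elim(2)] assms(2)[OF elim(2)]])
      ultimately show ?case by linarith
    qed
    show "\<forall>\<^sub>F k in sequentially. P k \<le> 1"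
      using eventually_gt
    proof eventually_elim
      case (elim k)
      interpret prob_space "M k" by (rule assms(3)) (rule elim)
      show ?case unfolding P_def by (rule prob_le_1)
    qed
    have "(\<lambda>k. exp (- 1 :: real) ^ k) \<longlonglongrightarrow> 0" by (rule LIMSEQ_realpow_zero) auto
    from tendsto_diff[OF tendsto_const[of "1 :: real"] this]
    show "(\<lambda>k. 1 - exp (- 1 :: real) ^ k) \<longlonglongrightarrow> 1" by simp
  qed auto
  ultimately show ?thesis unfolding r_def P_def by blast
qed

end
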